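(* Let $R\neq 0$ and $Q$ be two left-symmetric conformal algebras, and let $E=R\oplus Q$ (direct sum of $\mathbb{C}[\partial]$-modules). If $E$ has a left-symmetric conformal algebra structure such that $R$ is an ideal of $E$, then $E$ is isomorphic, as a left-symmetric conformal algebra, to a crossed product $R\natural^g_{\varphi,\psi}Q$ of $R$ and $Q$.
   Context: All vector spaces are over $\mathbb{C}$; $V[\lambda]$ is the space of polynomials in $\lambda$ with coefficients in $V$. A left-symmetric conformal algebra is a $\mathbb{C}[\partial]$-module $R$ with a $\mathbb{C}$-bilinear map ($\lambda$-product) $R\times R\to R[\lambda]$, $(a,b)\mapsto a_\lambda b$, such that for all $a,b,c\in R$: $(\partial a)_\lambda b=-\lambda\, a_\lambda b$, $a_\lambda(\partial b)=(\partial+\lambda)a_\lambda b$, and $(a_\lambda b)_{\lambda+\mu}c-a_\lambda(b_\mu c)=(b_\mu a)_{\lambda+\mu}c-b_\mu(a_\lambda c)$. "$R$ is an ideal of $E$" means that the $\lambda$-product of $E$ restricts to the given one on $R$ and that $a_\lambda e,\ e_\lambda a\in R[\lambda]$ for all $a\in R$, $e\in E$. For $\mathbb{C}[\partial]$-modules: a conformal linear map $U\to V$ is a $\mathbb{C}$-linear $\psi_\lambda:U\to V[\lambda]$ with $\psi_\lambda(\partial a)=(\partial+\lambda)\psi_\lambda a$; a conformal bilinear map is a $\mathbb{C}$-bilinear $f_\lambda:U\times V\to W[\lambda]$ with $f_\lambda(\partial a,b)=-\lambda f_\lambda(a,b)$, $f_\lambda(a,\partial b)=(\lambda+\partial)f_\lambda(a,b)$.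 $Cend(V)$ is the space of conformal linear maps $V\to V$, a $\mathbb{C}[\partial]$-module via $(\partial\varphi)_\lambda=-\lambda\varphi_\lambda$. If $f_\nu=\sum_i\nu^if_i$ then $f_{-\lambda-\partial}v=\sum_i(-\lambda-\partial)^if_i(v)$. Crossed product: for a left-symmetric conformal algebra $R$ and a $\mathbb{C}[\partial]$-module $Q$, consider systems $\Omega(R,Q)=(\varphi,\psi,g_\lambda(\cdot,\cdot),\circ_\lambda)$ of $\mathbb{C}[\partial]$-module homomorphisms $\varphi,\psi:Q\to Cend(R)$ and conformal bilinear maps $g_\lambda:Q\times Q\to R[\lambda]$, $\circ_\lambda:Q\times Q\to Q[\lambda]$ such that the $\mathbb{C}[\partial]$-module $R\oplus Q$ with $$(a+x)_\lambda(b+y)=\big(a_\lambda b+\varphi(x)_\lambda b+\psi(y)_{-\lambda-\partial}a+g_\lambda(x,y)\big)+x\circ_\lambda y,\qquad a,b\in R,\ x,y\in Q,$$ is a left-symmetric conformal algebra (then $(Q,\circ_\lambda)$ is itself a left-symmetric conformal algebra). This algebra is denoted $R\natural^g_{\varphi,\psi}Q$ and is called the crossed product of $R$ and $Q$ determined by the system. The product $\circ_\lambda$ on the $\mathbb{C}[\partial]$-module $Q$ is part of the system defining the crossed product. *)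

theory Defs
  imports
    "HOL-Analysis.Product_Vector"
    "HOL-Library.Function_Algebras"
    "HOL-Computational_Algebra.Polynomial"
begin

text \<open>
  A \<open>\<complex>[\<partial>]\<close>-module is a \<^locale>\<open>module\<close> over the ring \<^typ>\<open>complex poly\<close>, whose indeterminate is
  \<open>\<partial>\<close>.  The space \<open>V[\<lambda>]\<close> is the type \<open>'v poly\<close>, multiplication by \<open>\<lambda>\<close> being \<open>pCons 0\<close>.
\<close>

type_synonym 'v dscale = "complex poly \<Rightarrow> 'v \<Rightarrow> 'v"

definition cscale :: "'v dscale \<Rightarrow> complex \<Rightarrow> 'v \<Rightarrow> 'v" where
  "cscale s c = s [:c:]"

definition der :: "'v dscale \<Rightarrow> 'v \<Rightarrow> 'v" where
  "der s = s [:0, 1:]"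

definition lam_cscale :: "'v::ab_group_add dscale \<Rightarrow> complex \<Rightarrow> 'v poly \<Rightarrow> 'v poly" where
  "lam_cscale s c = map_poly (cscale s c)"

definition der_plus_lam :: "'v::ab_group_add dscale \<Rightarrow> 'v poly \<Rightarrow> 'v poly" where
  "der_plus_lam s p = map_poly (der s) p + pCons 0 p"

text \<open>
  Substituting an operator \<open>T\<close> for the indeterminate of \<open>p = \<Sum>i. \<nu>^i p_i\<close>, where the coefficients
  are first mapped by \<open>h\<close> into the space on which \<open>T\<close> acts: the result is \<open>\<Sum>i. T^i (h p_i)\<close>.
\<close>

definition subst_op :: "('w \<Rightarrow> 'w) \<Rightarrow> ('v \<Rightarrow> 'w) \<Rightarrow> 'v::zero poly \<Rightarrow> 'w::comm_monoid_add" where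
  "subst_op T h p = (\<Sum>i\<le>degree p. (T ^^ i) (h (coeff p i)))"

text \<open>\<open>f_{-\<lambda>-\<partial>} v\<close>, for \<open>p = f_\<nu> v\<close>; here \<open>v \<in> V\<close> is embedded in \<open>V[\<lambda>]\<close> as \<open>[:v:]\<close>.\<close>

definition at_minus_lam_der :: "'v::ab_group_add dscale \<Rightarrow> 'v poly \<Rightarrow> 'v poly" where
  "at_minus_lam_der s p = subst_op (\<lambda>q. - der_plus_lam s q) (\<lambda>v. [:v:]) p"

definition conformal_linear ::
  "'u::ab_group_add dscale \<Rightarrow> 'v::ab_group_add dscale \<Rightarrow> ('u \<Rightarrow> 'v poly) \<Rightarrow> bool" where
  "conformal_linear sU sV \<psi> \<longleftrightarrow>
     Vector_Spaces.linear (cscale sU) (lam_cscale sV) \<psi> \<and>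
     (\<forall>a. \<psi> (der sU a) = der_plus_lam sV (\<psi> a))"

definition conformal_bilinear ::
  "'u::ab_group_add dscale \<Rightarrow> 'v::ab_group_add dscale \<Rightarrow> 'w::ab_group_add dscale
   \<Rightarrow> ('u \<Rightarrow> 'v \<Rightarrow> 'w poly) \<Rightarrow> bool" where
  "conformal_bilinear sU sV sW f \<longleftrightarrow>
     (\<forall>b. Vector_Spaces.linear (cscale sU) (lam_cscale sW) (\<lambda>a. f a b)) \<and>
     (\<forall>a. Vector_Spaces.linear (cscale sV) (lam_cscale sW) (f a)) \<and>
     (\<forall>a b. f (der sU a) b = - pCons 0 (f a b)) \<and>
     (\<forall>a b. f a (der sV b) = der_plus_lam sW (f a b))"

text \<open>
  \<open>V[\<lambda>,\<mu>]\<close> is \<open>V[\<mu>][\<lambda>]\<close>: the outer indeterminate of \<open>'v poly poly\<close> is \<open>\<lambda>\<close>, the inner one is \<open>\<mu>\<close>.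
\<close>

definition lam_times :: "'v::ab_group_add poly poly \<Rightarrow> 'v poly poly" where
  "lam_times = pCons 0"

definition mu_times :: "'v::ab_group_add poly poly \<Rightarrow> 'v poly poly" where
  "mu_times = map_poly (pCons 0)"

definition lam_plus_mu_times :: "'v::ab_group_add poly poly \<Rightarrow> 'v poly poly" where
  "lam_plus_mu_times q = lam_times q + mu_times q"

definition const2 :: "'v::ab_group_add \<Rightarrow> 'v poly poly" where
  "const2 v = [:[:v:]:]"

text \<open>
  The four terms of the last axiom are, in order, \<open>(a_\<lambda> b)_{\<lambda>+\<mu>} c\<close>, \<open>a_\<lambda> (b_\<mu> c)\<close>,
  \<open>(b_\<mu> a)_{\<lambda>+\<mu>} c\<close> and \<open>b_\<mu> (a_\<lambda> c)\<close>.
\<close>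

locale lsca = module scale
  for scale :: "complex poly \<Rightarrow> 'a::ab_group_add \<Rightarrow> 'a" +
  fixes lprod :: "'a \<Rightarrow> 'a \<Rightarrow> 'a poly"
  assumes lprod_conformal: "conformal_bilinear scale scale scale lprod"
    and left_symmetry:
      "subst_op lam_times (\<lambda>u. subst_op lam_plus_mu_times const2 (lprod u c)) (lprod a b)
       - subst_op mu_times (\<lambda>u. subst_op lam_times const2 (lprod a u)) (lprod b c)
       = subst_op mu_times (\<lambda>u. subst_op lam_plus_mu_times const2 (lprod u c)) (lprod b a)
       - subst_op lam_times (\<lambda>u. subst_op mu_times const2 (lprod b u)) (lprod a c)"

definition lsca_isomorphic ::
  "'a::ab_group_add dscale \<Rightarrow> ('a \<Rightarrow> 'a \<Rightarrow> 'a poly)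
   \<Rightarrow> 'b::ab_group_add dscale \<Rightarrow> ('b \<Rightarrow> 'b \<Rightarrow> 'b poly) \<Rightarrow> bool" where
  "lsca_isomorphic sA mA sB mB \<longleftrightarrow>
     (\<exists>f. module_hom sA sB f \<and> bij f \<and> (\<forall>a b. map_poly f (mA a b) = mB (f a) (f b)))"

text \<open>
  The direct sum \<open>R \<oplus> Q\<close> is the product type with \<^const>\<open>module_prod.scale\<close>; \<open>R\<close> and \<open>Q\<close> are
  embedded by \<open>a \<mapsto> (a, 0)\<close> and \<open>x \<mapsto> (0, x)\<close>.
\<close>

abbreviation dsum_scale :: "'r::ab_group_add dscale \<Rightarrow> 'q::ab_group_add dscale \<Rightarrow> ('r \<times> 'q) dscale" where
  "dsum_scale \<equiv> module_prod.scale"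

definition first_summand_ideal ::
  "('r::ab_group_add \<Rightarrow> 'r \<Rightarrow> 'r poly)
   \<Rightarrow> ('r \<times> 'q::ab_group_add \<Rightarrow> 'r \<times> 'q \<Rightarrow> ('r \<times> 'q) poly) \<Rightarrow> bool" where
  "first_summand_ideal mR mE \<longleftrightarrow>
     (\<forall>a b. mE (a, 0) (b, 0) = map_poly (\<lambda>u. (u, 0)) (mR a b)) \<and>
     (\<forall>a e n. coeff (mE (a, 0) e) n \<in> range (\<lambda>u. (u, 0))) \<and>
     (\<forall>a e n. coeff (mE e (a, 0)) n \<in> range (\<lambda>u. (u, 0)))"

definition Cend :: "'v::ab_group_add dscale \<Rightarrow> ('v \<Rightarrow> 'v poly) set" where
  "Cend s = {\<phi>. conformal_linear s s \<phi>}"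

text \<open>
  The \<open>\<complex>[\<partial>]\<close>-module structure of \<open>Cend(V)\<close>, in which \<open>\<partial>\<close> acts as multiplication by \<open>-\<lambda>\<close>.  The same
  formula makes the space of all maps \<open>V \<Rightarrow> V[\<lambda>]\<close> a \<open>\<complex>[\<partial>]\<close>-module, with \<open>Cend(V)\<close> as a submodule.
\<close>

definition Cend_scale :: "'v::ab_group_add dscale \<Rightarrow> complex poly \<Rightarrow> ('v \<Rightarrow> 'v poly) \<Rightarrow> 'v \<Rightarrow> 'v poly" where
  "Cend_scale s p \<phi> = (\<lambda>a. subst_op (\<lambda>q. - pCons 0 q) (\<lambda>c. lam_cscale s c (\<phi> a)) p)"

definition crossed_product ::
  "'r::ab_group_add dscale \<Rightarrow> ('r \<Rightarrow> 'r \<Rightarrow> 'r poly)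
   \<Rightarrow> ('q::ab_group_add \<Rightarrow> 'r \<Rightarrow> 'r poly) \<Rightarrow> ('q \<Rightarrow> 'r \<Rightarrow> 'r poly)
   \<Rightarrow> ('q \<Rightarrow> 'q \<Rightarrow> 'r poly) \<Rightarrow> ('q \<Rightarrow> 'q \<Rightarrow> 'q poly)
   \<Rightarrow> 'r \<times> 'q \<Rightarrow> 'r \<times> 'q \<Rightarrow> ('r \<times> 'q) poly" where
  "crossed_product sR mR \<phi> \<psi> g circ = (\<lambda>(a, x) (b, y).
     map_poly (\<lambda>u. (u, 0)) (mR a b + \<phi> x b + at_minus_lam_der sR (\<psi> y a) + g x y)
     + map_poly (\<lambda>z. (0, z)) (circ x y))"

definition crossed_system ::
  "'r::ab_group_add dscale \<Rightarrow> ('r \<Rightarrow> 'r \<Rightarrow> 'r poly) \<Rightarrow> 'q::ab_group_add dscale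
   \<Rightarrow> ('q \<Rightarrow> 'r \<Rightarrow> 'r poly) \<Rightarrow> ('q \<Rightarrow> 'r \<Rightarrow> 'r poly)
   \<Rightarrow> ('q \<Rightarrow> 'q \<Rightarrow> 'r poly) \<Rightarrow> ('q \<Rightarrow> 'q \<Rightarrow> 'q poly) \<Rightarrow> bool" where
  "crossed_system sR mR sQ \<phi> \<psi> g circ \<longleftrightarrow>
     range \<phi> \<subseteq> Cend sR \<and> module_hom sQ (Cend_scale sR) \<phi> \<and>
     range \<psi> \<subseteq> Cend sR \<and> module_hom sQ (Cend_scale sR) \<psi> \<and>
     conformal_bilinear sQ sQ sR g \<and>
     conformal_bilinear sQ sQ sQ circ \<and>
     lsca (dsum_scale sR sQ) (crossed_product sR mR \<phi> \<psi> g circ)"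

end

theory Submission
  imports Defs
begin

text \<open>
  The isomorphism is the identity map: the given product on \<open>E\<close> already is a crossed product.  Split
  \<open>(a + x)\<^sub>\<lambda> (b + y)\<close> by biadditivity into four terms.  The first, \<open>a\<^sub>\<lambda> b\<close>, is the product of \<open>R\<close>
  because \<open>R\<close> is a subalgebra; \<open>x\<^sub>\<lambda> b\<close> and \<open>a\<^sub>\<lambda> y\<close> lie in \<open>R[\<lambda>]\<close> because \<open>R\<close> is an ideal; and
  \<open>x\<^sub>\<lambda> y\<close> has a component in \<open>R[\<lambda>]\<close>, taken as \<open>g\<^sub>\<lambda>(x, y)\<close>, and one in \<open>Q[\<lambda>]\<close>, taken as
  \<open>x \<circ>\<^sub>\<lambda> y\<close>.  In particular \<open>\<circ>\<^sub>\<lambda>\<close> is the product of the quotient algebra \<open>E / R\<close> transported along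
  \<open>x \<mapsto> x + R\<close>.

  These pieces arise from the product of \<open>E\<close> by precomposing with the inclusions of \<open>R\<close> and \<open>Q\<close> and
  projecting the coefficients, and such pieces are again conformal bilinear
  (\<open>conformal_bilinear_compose\<close>).  A conformal bilinear map \<open>U \<times> V \<rightarrow> V[\<lambda>]\<close> is the same thing as a
  \<open>\<complex>[\<partial>]\<close>-homomorphism \<open>U \<rightarrow> Cend(V)\<close> (\<open>conformal_bilinear_imp_Cend\<close>), which gives
  \<open>\<phi>(x)\<^sub>\<lambda> b = x\<^sub>\<lambda> b\<close>.  The right multiplications \<open>a \<mapsto> a\<^sub>\<lambda> y\<close> have the two sesquilinearity rules in
  the wrong slots.  The substitution \<open>\<lambda> \<mapsto> -\<lambda>-\<partial>\<close> interchanges the operators \<open>-\<lambda>\<close> and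
  \<open>\<partial>+\<lambda>\<close>, so that \<open>\<psi>(y)\<^sub>\<lambda> a = a\<^bsub>-\<lambda>-\<partial>\<^esub> y\<close> is of the right kind
  (\<open>conformal_bilinear_opposite\<close>); and it is an involution (\<open>at_minus_lam_der_involution\<close>), so that
  \<open>\<psi>(y)\<^bsub>-\<lambda>-\<partial>\<^esub> a\<close> gives back \<open>a\<^sub>\<lambda> y\<close>.
\<close>

section \<open>Coefficientwise maps and substitution of operators\<close>

lemma map_poly_add_additive:
  "additive h \<Longrightarrow> map_poly h (p + q) = map_poly h p + map_poly h q"
  by (rule poly_eqI) (simp add: coeff_map_poly additive.zero additive.add)

lemma map_poly_minus_additive:
  "additive h \<Longrightarrow> map_poly h (- p) = - map_poly h p"
  by (rule poly_eqI) (simp add: coeff_map_poly additive.zero additive.minus)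

lemma map_poly_pCons_additive:
  "additive h \<Longrightarrow> map_poly h (pCons a p) = pCons (h a) (map_poly h p)"
  by (simp add: map_poly_pCons additive.zero)

lemma map_poly_section:
  assumes k0: "k 0 = 0" and hk: "\<And>u. h (k u) = u" and range: "\<And>n. coeff p n \<in> range k"
  shows "map_poly k (map_poly h p) = p"
proof (rule poly_eqI)
  fix n
  obtain u where u: "coeff p n = k u" using range by blast
  have "h 0 = 0" using hk[of 0] by (simp add: k0)
  then show "coeff (map_poly k (map_poly h p)) n = coeff p n"
    by (simp add: coeff_map_poly k0 u hk)
qed

lemma module_hom_imp_additive: "module_hom s t h \<Longrightarrow> additive h"
  by (simp add: additive_def module_hom.add)

text \<open>
  The defining sum stops at the degree, which is awkward to compute with since sums of polynomials
  can have smaller degree; this Horner form is what all inductions over substitutions use.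
\<close>

lemma subst_op_pCons:
  assumes T: "additive T" and h: "h 0 = 0"
  shows "subst_op T h (pCons a p) = h a + T (subst_op T h p)"
proof -
  have T0: "(T ^^ i) 0 = 0" for i
    by (induction i) (simp_all add: additive.zero[OF T])
  have "subst_op T h (pCons a p) = (\<Sum>i\<le>Suc (degree p). (T ^^ i) (h (coeff (pCons a p) i)))"
    unfolding subst_op_def
    by (rule sum.mono_neutral_left) (auto simp: h T0 coeff_eq_0 degree_pCons_le)
  also have "\<dots> = h a + (\<Sum>i\<le>degree p. T ((T ^^ i) (h (coeff p i))))"
    by (subst sum.atMost_Suc_shift) simp
  also have "\<dots> = h a + T (subst_op T h p)"
    by (simp add: subst_op_def additive.sum[OF T])
  finally show ?thesis .
qed

lemma subst_op_0: "h 0 = 0 \<Longrightarrow> subst_op T h 0 = 0"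
  by (simp add: subst_op_def)

lemma subst_op_add:
  assumes T: "additive T" and h: "additive h"
  shows "subst_op T h (p + q) = subst_op T h p + subst_op T h q"
proof (induction p q rule: poly_induct2)
  case 0
  then show ?case by (simp add: subst_op_0 additive.zero[OF h])
next
  case (pCons a p b q)
  then show ?case
    by (simp add: subst_op_pCons T additive.zero[OF h] additive.add[OF h] additive.add[OF T])
qed

text \<open>
  For \<open>V[\<lambda>]\<close> and \<open>T = -\<lambda>\<close> this is the \<open>\<complex>[\<partial>]\<close>-module structure behind that of \<open>Cend(V)\<close>, which is
  obtained from it pointwise.
\<close>

lemma module_polynomial_action:
  fixes r :: "'c::comm_ring_1 \<Rightarrow> 'v::ab_group_add \<Rightarrow> 'v"
  assumes hom: "module_hom r r T"
  shows "module (\<lambda>p v. subst_op T (\<lambda>c. r c v) p)"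
proof -
  interpret module_hom r r T by fact
  have T: "additive T" by (rule module_hom_imp_additive[OF hom])
  define act where "act p v = subst_op T (\<lambda>c. r c v) p" for p v
  have 0: "act 0 v = 0" for v
    by (simp add: act_def subst_op_0)
  have Cons: "act (pCons a p) v = r a v + T (act p v)" for v a p
    unfolding act_def by (rule subst_op_pCons[OF T]) simp
  have left: "act (p + q) v = act p v + act q v" for p q v
    unfolding act_def by (rule subst_op_add[OF T]) (simp add: additive_def m1.scale_left_distrib)
  have right: "act p (v + w) = act p v + act p w" for p v w
    by (induction p) (simp_all add: 0 Cons add m1.scale_right_distrib)
  have smult: "act (smult a p) v = r a (act p v)" for a p v
    by (induction p) (simp_all add: 0 Cons scale m1.scale_right_distrib)
  have mult: "act p (act q v) = act (p * q) v" for p q v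
    by (induction p) (simp_all add: 0 Cons left smult)
  have "module act"
    by (rule module.intro) (simp_all add: left right mult Cons 0 one_pCons)
  then show ?thesis
    by (simp only: act_def[abs_def])
qed

section \<open>Derivation and substitution operators on \<open>V[\<lambda>]\<close>\<close>

lemma module_hom_scale:
  fixes s :: "'c::comm_ring_1 \<Rightarrow> 'v::ab_group_add \<Rightarrow> 'v"
  assumes "module s"
  shows "module_hom s s (s p)"
proof -
  interpret module s by fact
  show ?thesis
    by unfold_locales (simp_all add: scale_right_distrib mult.commute)
qed

lemma module_hom_der: "module s \<Longrightarrow> module_hom s s (der s)"
  by (simp add: der_def module_hom_scale)

lemma module_hom_cscale: "module s \<Longrightarrow> module_hom s s (cscale s c)"
  by (simp add: cscale_def module_hom_scale)

lemmas additive_der = module_hom_der[THEN module_hom_imp_additive]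
lemmas additive_cscale = module_hom_cscale[THEN module_hom_imp_additive]

lemma module_hom_commutes_der: "module_hom s t h \<Longrightarrow> h (der s a) = der t (h a)"
  by (simp add: der_def module_hom.scale)

lemma module_hom_commutes_cscale: "module_hom s t h \<Longrightarrow> h (cscale s c a) = cscale t c (h a)"
  by (simp add: cscale_def module_hom.scale)

lemma module_cscale:
  assumes "module s"
  shows "module (cscale s)"
proof -
  interpret module s by fact
  show ?thesis
    by (intro module.intro)
      (simp_all add: cscale_def scale_right_distrib mult.commute flip: scale_left_distrib one_pCons)
qed

lemma module_lam_cscale:
  assumes s: "module s"
  shows "module (lam_cscale s)"
proof -
  interpret c: module "cscale s" by (rule module_cscale[OF s])
  show ?thesis
    by (rule module.intro; rule poly_eqI)
      (simp_all add: lam_cscale_def coeff_map_poly c.scale_right_distrib c.scale_left_distrib)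
qed

lemma lam_cscale_pCons:
  "module s \<Longrightarrow> lam_cscale s c (pCons a p) = pCons (cscale s c a) (lam_cscale s c p)"
  by (simp add: lam_cscale_def map_poly_pCons_additive additive_cscale)

lemma der_plus_lam_0 [simp]: "der_plus_lam s 0 = 0"
  by (simp add: der_plus_lam_def)

lemma additive_der_plus_lam:
  fixes s :: "'a::ab_group_add dscale"
  assumes s: "module s"
  shows "additive (der_plus_lam s)"
proof (rule additive.intro)
  fix p q :: "'a poly"
  have "pCons 0 (p + q) = pCons 0 p + pCons 0 q" by simp
  then show "der_plus_lam s (p + q) = der_plus_lam s p + der_plus_lam s q"
    unfolding der_plus_lam_def map_poly_add_additive[OF additive_der[OF s]]
    by (simp only: add_ac)
qed

lemmas der_plus_lam_add = additive_der_plus_lam[THEN additive.add]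
lemmas der_plus_lam_minus = additive_der_plus_lam[THEN additive.minus]

lemma map_poly_der_plus_lam:
  assumes h: "module_hom s t h"
  shows "map_poly h (der_plus_lam s p) = der_plus_lam t (map_poly h p)"
proof -
  have h0: "h 0 = 0" and hadd: "additive h"
    using module_hom_imp_additive[OF h] by (simp_all add: additive.zero)
  have s: "module s" and t: "module t" using h by (simp_all add: module_hom_def)
  have "map_poly h (map_poly (der s) p) = map_poly (der t) (map_poly h p)"
    by (intro poly_eqI) (simp add: coeff_map_poly h0 additive_der[THEN additive.zero] s t
        module_hom_commutes_der[OF h])
  then show ?thesis
    by (simp add: der_plus_lam_def map_poly_add_additive[OF hadd] map_poly_pCons_additive[OF hadd] h0)
qed

lemma at_minus_lam_der_0 [simp]: "at_minus_lam_der s 0 = 0"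
  by (simp add: at_minus_lam_der_def subst_op_0)

lemma at_minus_lam_der_pCons:
  "module s \<Longrightarrow> at_minus_lam_der s (pCons a p) = [:a:] - der_plus_lam s (at_minus_lam_der s p)"
  unfolding at_minus_lam_der_def
  by (subst subst_op_pCons) (auto simp: additive_def der_plus_lam_add)

lemma additive_at_minus_lam_der: "module s \<Longrightarrow> additive (at_minus_lam_der s)"
  unfolding at_minus_lam_der_def
  by (subst additive_def, intro allI subst_op_add) (simp_all add: additive_def der_plus_lam_add)

lemmas at_minus_lam_der_add = additive_at_minus_lam_der[THEN additive.add]
lemmas at_minus_lam_der_minus = additive_at_minus_lam_der[THEN additive.minus]
lemmas at_minus_lam_der_diff = additive_at_minus_lam_der[THEN additive.diff]

lemma map_poly_at_minus_lam_der:
  assumes h: "module_hom s t h"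
  shows "map_poly h (at_minus_lam_der s p) = at_minus_lam_der t (map_poly h p)"
proof -
  have hadd: "additive h" by (rule module_hom_imp_additive[OF h])
  have s: "module s" and t: "module t" using h by (simp_all add: module_hom_def)
  note map_add = map_poly_add_additive[OF hadd] map_poly_minus_additive[OF hadd]
  show ?thesis
  proof (induction p)
    case (pCons a p)
    have "map_poly h ([:a:] - der_plus_lam s (at_minus_lam_der s p))
        = [:h a:] - der_plus_lam t (at_minus_lam_der t (map_poly h p))"
      unfolding diff_conv_add_uminus map_add map_poly_der_plus_lam[OF h] pCons.IH
      by (simp add: map_poly_pCons_additive[OF hadd])
    then show ?case
      by (simp add: at_minus_lam_der_pCons s t map_poly_pCons_additive[OF hadd])
  qed simp
qed

text \<open>
  This and the next lemma say together that \<open>\<lambda> \<mapsto> -\<lambda>-\<partial>\<close> interchanges the operators \<open>-\<lambda>\<close> and \<open>\<partial>+\<lambda>\<close>.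
  Since \<open>\<partial>\<close> itself commutes with the substitution, the second follows from
  \<open>\<partial> + (-\<lambda>-\<partial>) = -\<lambda>\<close>.
\<close>

lemma at_minus_lam_der_pCons_0:
  "module s \<Longrightarrow> at_minus_lam_der s (pCons 0 p) = - der_plus_lam s (at_minus_lam_der s p)"
  by (simp add: at_minus_lam_der_pCons)

lemma at_minus_lam_der_der_plus_lam:
  assumes s: "module s"
  shows "at_minus_lam_der s (der_plus_lam s p) = - pCons 0 (at_minus_lam_der s p)"
proof -
  have "at_minus_lam_der s (der_plus_lam s p)
      = map_poly (der s) (at_minus_lam_der s p) - der_plus_lam s (at_minus_lam_der s p)"
    by (simp add: der_plus_lam_def[of s p] at_minus_lam_der_add s at_minus_lam_der_pCons_0
        map_poly_at_minus_lam_der[OF module_hom_der])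
  also have "\<dots> = - pCons 0 (at_minus_lam_der s p)"
    by (simp add: der_plus_lam_def)
  finally show ?thesis .
qed

text \<open>
  Carrying out the substitution twice sends \<open>\<lambda>\<close> to \<open>-(-\<lambda>-\<partial>)-\<partial> = \<lambda>\<close>.
\<close>

lemma at_minus_lam_der_involution:
  assumes s: "module s"
  shows "at_minus_lam_der s (at_minus_lam_der s p) = p"
proof (induction p)
  case (pCons a p)
  then show ?case
    by (simp add: at_minus_lam_der_pCons s at_minus_lam_der_diff at_minus_lam_der_der_plus_lam)
qed simp

section \<open>Conformal bilinear maps\<close>

lemma conformal_bilinear_iff:
  assumes "module sU" "module sV" "module sW"
  shows "conformal_bilinear sU sV sW f \<longleftrightarrow>
     (\<forall>a a' b. f (a + a') b = f a b + f a' b) \<and>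
     (\<forall>a b b'. f a (b + b') = f a b + f a b') \<and>
     (\<forall>c a b. f (cscale sU c a) b = lam_cscale sW c (f a b)) \<and>
     (\<forall>c a b. f a (cscale sV c b) = lam_cscale sW c (f a b)) \<and>
     (\<forall>a b. f (der sU a) b = - pCons 0 (f a b)) \<and>
     (\<forall>a b. f a (der sV b) = der_plus_lam sW (f a b))"
  unfolding conformal_bilinear_def linear_iff_module_hom module_hom_def module_hom_axioms_def
  using assms by (auto simp: module_cscale module_lam_cscale)

lemma conformal_bilinear_compose:
  assumes f: "conformal_bilinear sU sV sW f"
    and i: "module_hom sU' sU i" and j: "module_hom sV' sV j" and h: "module_hom sW sW' h"
  shows "conformal_bilinear sU' sV' sW' (\<lambda>u v. map_poly h (f (i u) (j v)))"
proof -
  have mods: "module sU" "module sV" "module sW" "module sU'" "module sV'" "module sW'"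
    using i j h by (simp_all add: module_hom_def)
  have hadd: "additive h" by (rule module_hom_imp_additive[OF h])
  have h0: "h 0 = 0" by (rule additive.zero[OF hadd])
  have c: "map_poly h (lam_cscale sW c p) = lam_cscale sW' c (map_poly h p)" for c p
    by (intro poly_eqI) (simp add: lam_cscale_def coeff_map_poly h0
        additive_cscale[THEN additive.zero] mods module_hom_commutes_cscale[OF h])
  show ?thesis
    using f
    by (simp add: conformal_bilinear_iff mods module_hom.add[OF i] module_hom.add[OF j]
        module_hom_commutes_cscale[OF i] module_hom_commutes_cscale[OF j]
        module_hom_commutes_der[OF i] module_hom_commutes_der[OF j]
        map_poly_add_additive[OF hadd] map_poly_minus_additive[OF hadd]
        map_poly_pCons_additive[OF hadd] h0 c map_poly_der_plus_lam[OF h])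
qed

lemma conformal_bilinear_opposite:
  assumes f: "conformal_bilinear sU sV sW f"
    and mods: "module sU" "module sV" "module sW"
  shows "conformal_bilinear sV sU sW (\<lambda>v u. at_minus_lam_der sW (f u v))"
proof -
  have c: "at_minus_lam_der sW (lam_cscale sW c p) = lam_cscale sW c (at_minus_lam_der sW p)" for c p
    by (simp add: lam_cscale_def map_poly_at_minus_lam_der[OF module_hom_cscale[OF mods(3)]])
  show ?thesis
    using f
    by (simp add: conformal_bilinear_iff mods at_minus_lam_der_add at_minus_lam_der_minus
        der_plus_lam_minus
        c at_minus_lam_der_pCons_0 at_minus_lam_der_der_plus_lam)
qed

lemma module_Cend_scale:
  assumes s: "module s"
  shows "module (Cend_scale s)"
proof -
  interpret l: module "lam_cscale s" by (rule module_lam_cscale[OF s])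
  have "module_hom (lam_cscale s) (lam_cscale s) (\<lambda>q. - pCons 0 q)"
    by unfold_locales (simp_all add: lam_cscale_pCons s additive_cscale[THEN additive.zero])
  from module_polynomial_action[OF this] interpret p: module
    "\<lambda>p v. subst_op (\<lambda>q. - pCons 0 q) (\<lambda>c. lam_cscale s c v) p" .
  show ?thesis
    by (rule module.intro; rule ext)
      (simp_all only: Cend_scale_def plus_fun_apply p.scale_right_distrib p.scale_left_distrib
        p.scale_scale p.scale_one)
qed

text \<open>
  In the second slot the axioms of a conformal bilinear map say that its values are in \<open>Cend(V)\<close>; in
  the first they say that it is linear and intertwines \<open>\<partial>\<close> with the operator \<open>-\<lambda>\<close>, by which \<open>\<partial>\<close> acts
  on \<open>Cend(V)\<close>.
\<close>

lemma conformal_bilinear_imp_Cend: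
  assumes f: "conformal_bilinear sU sV sV f" and U: "module sU" and V: "module sV"
  shows "range f \<subseteq> Cend sV" and "module_hom sU (Cend_scale sV) f"
proof -
  show "range f \<subseteq> Cend sV"
    using f by (auto simp: Cend_def conformal_linear_def conformal_bilinear_def)
  interpret U: module sU by fact
  interpret l: module "lam_cscale sV" by (rule module_lam_cscale[OF V])
  interpret C: module "Cend_scale sV" by (rule module_Cend_scale[OF V])
  have fadd: "f (x + y) b = f x b + f y b"
    and fc: "f (cscale sU c x) b = lam_cscale sV c (f x b)"
    and fd: "f (der sU x) b = - pCons 0 (f x b)" for x y b c
    using f by (simp_all add: conformal_bilinear_iff U V)
  have f0: "f 0 b = 0" for b
    using fadd[of 0 0 b] by simp
  have "f (sU p x) b = Cend_scale sV p (f x) b" for p x b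
  proof (induction p)
    case 0
    then show ?case by (simp add: f0)
  next
    case (pCons a p)
    have "sU (pCons a p) x = cscale sU a x + der sU (sU p x)"
      by (simp add: cscale_def der_def flip: U.scale_left_distrib)
    then show ?case
      using pCons.IH
      by (simp add: fadd fc fd Cend_scale_def subst_op_pCons additive_def)
  qed
  then show "module_hom sU (Cend_scale sV) f"
    by unfold_locales (auto simp: fadd fun_eq_iff)
qed

section \<open>Algebras with a complemented ideal\<close>

theorem proposition5p1:
  fixes sR :: "complex poly \<Rightarrow> 'r::ab_group_add \<Rightarrow> 'r"
    and mR :: "'r \<Rightarrow> 'r \<Rightarrow> 'r poly"
    and sQ :: "complex poly \<Rightarrow> 'q::ab_group_add \<Rightarrow> 'q"
    and mQ :: "'q \<Rightarrow> 'q \<Rightarrow> 'q poly"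
    and mE :: "'r \<times> 'q \<Rightarrow> 'r \<times> 'q \<Rightarrow> ('r \<times> 'q) poly"
  assumes "lsca sR mR"
    and "\<exists>a::'r. a \<noteq> 0"
    and "lsca sQ mQ"
    and "lsca (dsum_scale sR sQ) mE"
    and "first_summand_ideal mR mE"
  shows "\<exists>\<phi> \<psi> g circ.
    crossed_system sR mR sQ \<phi> \<psi> g circ \<and>
    lsca_isomorphic (dsum_scale sR sQ) mE
      (dsum_scale sR sQ) (crossed_product sR mR \<phi> \<psi> g circ)"
proof -
  let ?E = "dsum_scale sR sQ"
  let ?inR = "\<lambda>u::'r. (u, 0::'q)" and ?inQ = "\<lambda>z::'q. (0::'r, z)"
  have R: "module sR" and Q: "module sQ" and E: "module ?E"
    using assms(1,3,4) by (simp_all add: lsca_def)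
  interpret R: module sR by fact
  interpret Q: module sQ by fact
  interpret RQ: module_prod sR sQ by unfold_locales
  have inR: "module_hom sR ?E ?inR" and inQ: "module_hom sQ ?E ?inQ"
    by unfold_locales (simp_all add: RQ.scale_prod)
  have mE: "conformal_bilinear ?E ?E ?E mE"
    using assms(4) by (simp add: lsca_def lsca_axioms_def)

  define \<phi> where "\<phi> x b = map_poly fst (mE (0, x) (b, 0))" for x b
  define \<rho> where "\<rho> a y = map_poly fst (mE (a, 0) (0, y))" for a y
  define \<psi> where "\<psi> y a = at_minus_lam_der sR (\<rho> a y)" for y a
  define g where "g x y = map_poly fst (mE (0, x) (0, y))" for x y
  define circ where "circ x y = map_poly snd (mE (0, x) (0, y))" for x y

  have \<phi>: "conformal_bilinear sQ sR sR \<phi>"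
    using conformal_bilinear_compose[OF mE inQ inR RQ.module_hom_fst] by (simp add: \<phi>_def[abs_def])
  have \<rho>: "conformal_bilinear sR sQ sR \<rho>"
    using conformal_bilinear_compose[OF mE inR inQ RQ.module_hom_fst] by (simp add: \<rho>_def[abs_def])
  have \<psi>: "conformal_bilinear sQ sR sR \<psi>"
    using conformal_bilinear_opposite[OF \<rho> R Q R] by (simp add: \<psi>_def[abs_def])
  have g: "conformal_bilinear sQ sQ sR g"
    using conformal_bilinear_compose[OF mE inQ inQ RQ.module_hom_fst] by (simp add: g_def[abs_def])
  have circ: "conformal_bilinear sQ sQ sQ circ"
    using conformal_bilinear_compose[OF mE inQ inQ RQ.module_hom_snd] by (simp add: circ_def[abs_def])

  have "mE (a, x) (b, y) = crossed_product sR mR \<phi> \<psi> g circ (a, x) (b, y)" for a b x y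
  proof -
    have add: "mE (u + u') v = mE u v + mE u' v" "mE u (v + v') = mE u v + mE u v'" for u u' v v'
      using mE unfolding conformal_bilinear_iff[OF E E E] by blast+
    have inR_add: "additive ?inR" by (simp add: additive_def)
    have "mE (a, x) (b, y) = mE ((a, 0) + (0, x)) ((b, 0) + (0, y))" by simp
    also have "\<dots> = mE (a, 0) (b, 0) + mE (0, x) (b, 0) + mE (a, 0) (0, y) + mE (0, x) (0, y)"
      by (simp only: add add_ac)
    also have "mE (a, 0) (b, 0) = map_poly ?inR (mR a b)"
      using assms(5) by (simp add: first_summand_ideal_def)
    also have "mE (0, x) (b, 0) = map_poly ?inR (\<phi> x b)"
      unfolding \<phi>_def using assms(5)
      by (intro map_poly_section[symmetric]) (simp_all add: first_summand_ideal_def zero_prod_def)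
    also have "mE (a, 0) (0, y) = map_poly ?inR (at_minus_lam_der sR (\<psi> y a))"
      unfolding \<psi>_def at_minus_lam_der_involution[OF R] \<rho>_def using assms(5)
      by (intro map_poly_section[symmetric]) (simp_all add: first_summand_ideal_def zero_prod_def)
    also have "mE (0, x) (0, y) = map_poly ?inR (g x y) + map_poly ?inQ (circ x y)"
      by (rule poly_eqI) (simp add: g_def circ_def coeff_map_poly zero_prod_def[symmetric])
    finally show ?thesis
      by (simp add: crossed_product_def map_poly_add_additive[OF inR_add] add_ac)
  qed
  then have eq: "crossed_product sR mR \<phi> \<psi> g circ = mE"
    by (auto simp: fun_eq_iff)

  have "crossed_system sR mR sQ \<phi> \<psi> g circ"
    unfolding crossed_system_def eq
    using conformal_bilinear_imp_Cend[OF \<phi> Q R] conformal_bilinear_imp_Cend[OF \<psi> Q R] g circ assms(4)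
    by blast
  moreover have "lsca_isomorphic ?E mE ?E (crossed_product sR mR \<phi> \<psi> g circ)"
    unfolding eq lsca_isomorphic_def
    using RQ.p.module_hom_id by (intro exI[of _ id]) simp
  ultimately show ?thesis by blast
qed

end
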